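(* Let $c\in[0,1)$, let $f:\mathbb{R}\to\mathbb{R}$ be continuous, and let $a$ be a real number such that $|f(t)|\le a|t|$ for all $t\in\mathbb{R}$. If $$a<\frac{1+c}{2},$$ then the origin is globally attracting for the difference equation $$x_{n+1}=cx_n+f(x_n-x_{n-1}),\qquad n=1,2,\ldots,$$ that is, for all real initial values $x_0,x_1$ the solution satisfies $\lim_{n\to\infty}x_n=0$.
   Context: A solution of the difference equation is a real sequence $\{x_n\}_{n\ge 0}$ satisfying it for all $n\ge 1$; it is determined by arbitrary real initial values $x_0,x_1$. The origin is globally attracting if every solution converges to $0$. *)

theory Defs
  imports Complex_Main
begin

text \<open>
  A solution of the second-order difference equation \<open>x (n+1) = F (x n) (x (n-1))\<close>, \<open>n = 1, 2, ...\<close>.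
  The values \<open>x 0\<close> and \<open>x 1\<close> are unconstrained; the guard \<open>n \<ge> 1\<close> keeps
  \<open>n - 1\<close> free of truncation.
\<close>
definition is_solution :: "(real \<Rightarrow> real \<Rightarrow> real) \<Rightarrow> (nat \<Rightarrow> real) \<Rightarrow> bool" where
  "is_solution F x \<longleftrightarrow> (\<forall>n\<ge>1. x (n + 1) = F (x n) (x (n - 1)))"

definition origin_globally_attracting :: "(real \<Rightarrow> real \<Rightarrow> real) \<Rightarrow> bool" where
  "origin_globally_attracting F \<longleftrightarrow> (\<forall>x. is_solution F x \<longrightarrow> x \<longlonglongrightarrow> 0)"

end

theory Submission
  imports Defs
begin

text \<open>
  Read the equation as a feedback loop.  The linear part \<open>x (n+1) = c * x n + w n\<close> turns the input
  \<open>w\<close> into the increments \<open>d n = x n - x (n-1)\<close>, and the nonlinearity closes the loop by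
  \<open>w n = f (d n)\<close>.  On square-summable sequences the linear part has transfer function
  \<open>(z - 1) / (z * (z - c))\<close>, whose modulus on the unit circle is largest at \<open>z = -1\<close>, where
  it is \<open>2 / (1 + c)\<close>; the nonlinearity has gain at most \<open>a\<close>.  The hypothesis says precisely that the
  product of the two gains is below \<open>1\<close>, so this is a small-gain theorem.

  The frequency-domain bound has an elementary certificate, the identity
  \<open>increment_gain_identity\<close>.  It shows that the weighted energy
  \<open>2 * (1 - c\<^sup>2) * (x n)\<^sup>2 + (1 + c)\<^sup>2 * (d n)\<^sup>2\<close> drops in each step by at least
  \<open>((1 + c)\<^sup>2 - 4 * a\<^sup>2) * (d n)\<^sup>2\<close>.  The drops of a nonincreasing nonnegative quantity tend to zero,
  hence \<open>d n \<longlonglongrightarrow> 0\<close>.  Finally \<open>d (n+1) = f (d n) - (1 - c) * x n\<close> with \<open>c < 1\<close> carries the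
  convergence over from the increments to \<open>x\<close> itself.
\<close>

text \<open>
  With \<open>u\<close> and \<open>v\<close> the new and the old value, \<open>u - c * v\<close> is the input and \<open>u - v\<close> the
  increment.  The difference of squares telescopes along a solution, and the square that is left over
  vanishes, for real \<open>c < 1\<close>, only when \<open>u = -v\<close>: the alternating mode in which the gain \<open>2 / (1 + c)\<close> is attained.
\<close>
lemma increment_gain_identity:
  fixes c u v :: "'a :: comm_ring_1"
  shows "4 * (u - c * v)\<^sup>2 =
    (1 + c)\<^sup>2 * (u - v)\<^sup>2 + 2 * (1 - c\<^sup>2) * (u\<^sup>2 - v\<^sup>2) + (1 - c)\<^sup>2 * (u + v)\<^sup>2"
  by (simp add: power2_eq_square algebra_simps)

lemma energy_drop:
  fixes a c u v d w :: real
  assumes "u = c * v + w" and "\<bar>w\<bar> \<le> a * \<bar>d\<bar>"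
  shows "2 * (1 - c\<^sup>2) * u\<^sup>2 + (1 + c)\<^sup>2 * (u - v)\<^sup>2 + ((1 + c)\<^sup>2 - 4 * a\<^sup>2) * d\<^sup>2
    \<le> 2 * (1 - c\<^sup>2) * v\<^sup>2 + (1 + c)\<^sup>2 * d\<^sup>2"
proof -
  have "w\<^sup>2 \<le> a\<^sup>2 * d\<^sup>2"
    using power_mono[OF assms(2), of 2] by (simp add: power_mult_distrib)
  moreover have "w = u - c * v"
    using assms(1) by simp
  ultimately have "4 * (u - c * v)\<^sup>2 \<le> 4 * (a\<^sup>2 * d\<^sup>2)"
    by simp
  moreover have "0 \<le> (1 - c)\<^sup>2 * (u + v)\<^sup>2"
    by simp
  ultimately show ?thesis
    using increment_gain_identity[of u c v] by (simp only: algebra_simps)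
qed

text \<open>The usual conclusion from a Lyapunov function whose decrease controls a nonnegative quantity.\<close>
lemma dissipation_tendsto_0:
  fixes V q :: "nat \<Rightarrow> real"
  assumes "\<And>n. 0 \<le> V n" and "\<And>n. 0 \<le> q n" and "0 < \<eta>"
    and drop: "\<And>n. V (Suc n) + \<eta> * q n \<le> V n"
  shows "q \<longlonglongrightarrow> 0"
proof -
  have "V (Suc n) \<le> V n" for n
    using drop[of n] mult_nonneg_nonneg[OF less_imp_le[OF assms(3)] assms(2)[of n]] by linarith
  then have "decseq V"
    by (simp add: decseq_SucI)
  then obtain L where L: "V \<longlonglongrightarrow> L"
    using decseq_convergent[of V 0] assms(1) by blast
  have "(\<lambda>n. (V n - V (Suc n)) / \<eta>) \<longlonglongrightarrow> (L - L) / \<eta>"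
    using assms(3) by (intro tendsto_intros L LIMSEQ_Suc) simp
  then have "(\<lambda>n. (V n - V (Suc n)) / \<eta>) \<longlonglongrightarrow> 0"
    by simp
  moreover have "q n \<le> (V n - V (Suc n)) / \<eta>" for n
    using drop[of n] assms(3) by (simp add: field_simps)
  ultimately show ?thesis
    using tendsto_sandwich[of "\<lambda>_. 0" q sequentially "\<lambda>n. (V n - V (Suc n)) / \<eta>" 0] assms(2)
    by simp
qed

theorem theorem2p1:
  fixes c a :: real and f :: "real \<Rightarrow> real"
  assumes "0 \<le> c" and "c < 1"
    and "continuous_on UNIV f"
    and "\<And>t. \<bar>f t\<bar> \<le> a * \<bar>t\<bar>"
    and "a < (1 + c) / 2"
  shows "origin_globally_attracting (\<lambda>u v. c * u + f (u - v))"
  unfolding origin_globally_attracting_def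
proof (intro allI impI)
  fix x :: "nat \<Rightarrow> real"
  assume sol: "is_solution (\<lambda>u v. c * u + f (u - v)) x"
  define d where "d n = x (Suc n) - x n" for n
  have step: "x (Suc (Suc n)) = c * x (Suc n) + f (d n)" for n
    using sol[unfolded is_solution_def, rule_format, of "Suc n"] by (simp add: d_def)
  have "0 \<le> a"
    using assms(4)[of 1] by simp
  then have "(2 * a)\<^sup>2 < (1 + c)\<^sup>2"
    using assms(5) by (intro power_strict_mono) auto
  then have gain: "0 < (1 + c)\<^sup>2 - 4 * a\<^sup>2"
    by (simp add: power_mult_distrib)
  have "c\<^sup>2 \<le> 1"
    using assms(1,2) by (simp add: power_le_one)
  then have d_sq: "(\<lambda>n. (d n)\<^sup>2) \<longlonglongrightarrow> 0"
    using energy_drop[OF step assms(4)]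
    by (intro dissipation_tendsto_0
        [where V = "\<lambda>n. 2 * (1 - c\<^sup>2) * (x (Suc n))\<^sup>2 + (1 + c)\<^sup>2 * (d n)\<^sup>2", OF _ _ gain])
      (simp_all add: d_def)
  then have d: "d \<longlonglongrightarrow> 0"
    by simp
  have "(\<lambda>n. a * \<bar>d n\<bar>) \<longlonglongrightarrow> 0"
    using tendsto_mult_right_zero[OF tendsto_rabs_zero[OF d]] .
  then have fd: "(\<lambda>n. f (d n)) \<longlonglongrightarrow> 0"
    by (rule tendsto_0_le[where K = 1]) (simp add: order_trans[OF assms(4) abs_ge_self])
  have "(\<lambda>n. (f (d n) - d (Suc n)) / (1 - c)) \<longlonglongrightarrow> (0 - 0) / (1 - c)"
    using assms(2) by (intro tendsto_intros fd LIMSEQ_Suc[OF d]) simp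
  moreover have "(f (d n) - d (Suc n)) / (1 - c) = x (Suc n)" for n
    using step[of n] assms(2) by (simp add: d_def field_simps)
  ultimately have "(\<lambda>n. x (Suc n)) \<longlonglongrightarrow> 0"
    by simp
  then show "x \<longlonglongrightarrow> 0"
    by (rule LIMSEQ_imp_Suc)
qed

end
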